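(* Let $G$ be an equitably 4-colorable graph on $n\ge 2$ vertices and let $k\ge 1$. Then for every integer $l\ge 1$, $\chi_{=}(G\circ^l C_{2k+1})=4$.
   Context: All graphs are finite, simple and connected. $C_m$ denotes the cycle on $m$ vertices. A graph is equitably $k$-colorable if its vertex set can be partitioned into $k$ (possibly empty) independent sets $V_1,\dots,V_k$ with $||V_i|-|V_j||\le 1$ for all $i,j$; $\chi_{=}(G)$ is the least $k$ for which $G$ is equitably $k$-colorable. The corona $G\circ H$ is formed from one copy of $G$ and $|V(G)|$ copies of $H$, the $i$-th vertex of $G$ being joined to every vertex of the $i$-th copy of $H$; $G\circ^1 H=G\circ H$ and $G\circ^l H=(G\circ^{l-1}H)\circ H$ for $l\ge 2$. *)

theory Defs
  imports "Graph_Theory.Graph_Theory"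
begin

text \<open>Undirected simple graphs are symmetric loop-free digraphs without parallel arcs
  (locale \<^locale>\<open>pair_graph\<close>): every edge is represented by its two arcs.\<close>

definition independent_set :: "'a pair_pre_digraph \<Rightarrow> 'a set \<Rightarrow> bool" where
  "independent_set G S \<longleftrightarrow> S \<subseteq> pverts G \<and> (\<forall>u\<in>S. \<forall>v\<in>S. (u, v) \<notin> parcs G)"

text \<open>The colour classes \<open>V i\<close> are indexed (rather than collected in a set of sets) because
  several of them may be empty.\<close>

definition equitably_colorable :: "nat \<Rightarrow> 'a pair_pre_digraph \<Rightarrow> bool" where
  "equitably_colorable k G \<longleftrightarrow>
     (\<exists>V :: nat \<Rightarrow> 'a set.
        (\<Union>i<k. V i) = pverts G \<and>
        disjoint_family_on V {..<k} \<and>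
        (\<forall>i<k. independent_set G (V i)) \<and>
        (\<forall>i<k. \<forall>j<k. \<bar>int (card (V i)) - int (card (V j))\<bar> \<le> 1))"

definition equitable_chromatic_number :: "'a pair_pre_digraph \<Rightarrow> nat" where
  "equitable_chromatic_number G = (LEAST k. equitably_colorable k G)"

text \<open>The cycle on \<open>m\<close> vertices; it is a simple graph only for \<open>m \<ge> 3\<close>.\<close>

definition cycle_graph :: "nat \<Rightarrow> nat pair_pre_digraph" where
  "cycle_graph m =
     \<lparr> pverts = {..<m},
       parcs = {(i, j). i < m \<and> j < m \<and> (j = Suc i mod m \<or> i = Suc j mod m)} \<rparr>"

text \<open>\<open>Inl v\<close> is the vertex \<open>v\<close> of \<open>G\<close>, and \<open>Inr (v, x)\<close> is the vertex \<open>x\<close> of the copy of \<open>H\<close>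
  that belongs to \<open>v\<close>.\<close>

definition corona :: "'a pair_pre_digraph \<Rightarrow> 'b pair_pre_digraph
    \<Rightarrow> ('a + 'a \<times> 'b) pair_pre_digraph" where
  "corona G H =
     \<lparr> pverts = Inl ` pverts G \<union> Inr ` (pverts G \<times> pverts H),
       parcs = {(Inl u, Inl v) | u v. (u, v) \<in> parcs G}
             \<union> {(Inr (v, x), Inr (v, y)) | v x y. v \<in> pverts G \<and> (x, y) \<in> parcs H}
             \<union> {(Inl v, Inr (v, x)) | v x. v \<in> pverts G \<and> x \<in> pverts H}
             \<union> {(Inr (v, x), Inl v) | v x. v \<in> pverts G \<and> x \<in> pverts H} \<rparr>"

text \<open>Each corona changes the type of the vertices. To iterate it, the vertices are relabelled
  into a single recursive type by the injective constructors \<open>Base\<close> and \<open>Step\<close>; this yields the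
  iterated corona up to isomorphism.\<close>

datatype ('a, 'b) corona_vertex =
    Base 'a
  | Step "('a, 'b) corona_vertex + ('a, 'b) corona_vertex \<times> 'b"

definition relabel :: "('a \<Rightarrow> 'c) \<Rightarrow> 'a pair_pre_digraph \<Rightarrow> 'c pair_pre_digraph" where
  "relabel f G = \<lparr> pverts = f ` pverts G, parcs = map_prod f f ` parcs G \<rparr>"

primrec iterated_corona :: "nat \<Rightarrow> 'a pair_pre_digraph \<Rightarrow> 'b pair_pre_digraph
    \<Rightarrow> ('a, 'b) corona_vertex pair_pre_digraph" where
  "iterated_corona 0 G H = relabel Base G"
| "iterated_corona (Suc l) G H = relabel Step (corona (iterated_corona l G H) H)"

lemma pair_graph_iff:
  "pair_graph G \<longleftrightarrow> finite (pverts G) \<and> parcs G \<subseteq> pverts G \<times> pverts G \<and> sym (parcs G) \<and> irrefl (parcs G)"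
proof
  assume "pair_graph G"
  then interpret pair_graph G .
  show "finite (pverts G) \<and> parcs G \<subseteq> pverts G \<times> pverts G \<and> sym (parcs G) \<and> irrefl (parcs G)"
    using pair_finite_verts in_arcsD1 in_arcsD2 pair_sym_arcs pair_no_loops
    by (fastforce simp: symmetric_def irrefl_def)
next
  assume *: "finite (pverts G) \<and> parcs G \<subseteq> pverts G \<times> pverts G \<and> sym (parcs G) \<and> irrefl (parcs G)"
  then have "finite (parcs G)"
    using finite_subset by blast
  with * show "pair_graph G"
    by unfold_locales (auto simp: symmetric_def irrefl_def)
qed

lemma pair_graph_cycle_graph:
  assumes "m \<ge> 3"
  shows "pair_graph (cycle_graph m)"
proof -
  have "i \<noteq> Suc i mod m" if "i < m" for i
    using assms that by (cases "Suc i = m") auto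
  then show ?thesis
    by (auto simp: pair_graph_iff cycle_graph_def sym_def irrefl_def)
qed

lemma pair_graph_corona:
  assumes "pair_graph G" "pair_graph H"
  shows "pair_graph (corona G H)"
  unfolding pair_graph_iff
proof (intro conjI)
  have GH: "finite (pverts G)" "parcs G \<subseteq> pverts G \<times> pverts G" "sym (parcs G)" "irrefl (parcs G)"
    "finite (pverts H)" "parcs H \<subseteq> pverts H \<times> pverts H" "sym (parcs H)" "irrefl (parcs H)"
    using assms unfolding pair_graph_iff by blast+
  show "finite (pverts (corona G H))"
    using GH by (simp add: corona_def)
  show "parcs (corona G H) \<subseteq> pverts (corona G H) \<times> pverts (corona G H)"
    using GH(2,6) by (auto simp: corona_def)
  show "sym (parcs (corona G H))"
    using GH(3,7) by (auto simp: corona_def sym_def)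
  show "irrefl (parcs (corona G H))"
    using GH(4,8) by (simp add: corona_def irrefl_def)
qed

lemma pair_graph_relabel:
  assumes "pair_graph G" "inj f"
  shows "pair_graph (relabel f G)"
  unfolding pair_graph_iff
proof (intro conjI)
  have G: "finite (pverts G)" "parcs G \<subseteq> pverts G \<times> pverts G" "sym (parcs G)" "irrefl (parcs G)"
    using assms(1) unfolding pair_graph_iff by blast+
  show "finite (pverts (relabel f G))"
    using G by (simp add: relabel_def)
  show "parcs (relabel f G) \<subseteq> pverts (relabel f G) \<times> pverts (relabel f G)"
    using G(2) by (auto simp: relabel_def)
  show "sym (parcs (relabel f G))"
    using G(3) by (force simp: relabel_def sym_def)
  show "irrefl (parcs (relabel f G))"
    using G(4) assms(2) by (auto simp: relabel_def irrefl_def inj_def)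
qed

lemma pair_graph_iterated_corona:
  assumes "pair_graph G" "pair_graph H"
  shows "pair_graph (iterated_corona l G H)"
  using assms by (induction l) (simp_all add: pair_graph_relabel pair_graph_corona inj_def)

lemma relabel_relabel: "relabel f (relabel g G) = relabel (f \<circ> g) G"
  by (simp add: relabel_def image_comp prod.map_comp)

lemma iterated_corona_1:
  fixes G :: "'a pair_pre_digraph" and H :: "'b pair_pre_digraph"
  shows "iterated_corona 1 G H = relabel (Step \<circ> map_sum Base (map_prod Base id)) (corona G H)"
proof -
  let ?f = "map_sum Base (map_prod Base id) ::
    'a + 'a \<times> 'b \<Rightarrow> ('a, 'b) corona_vertex + ('a, 'b) corona_vertex \<times> 'b"
  have verts: "pverts (corona (relabel Base G) H) = pverts (relabel ?f (corona G H))"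
    by (force simp: corona_def relabel_def image_Un image_image)
  have "(p, q) \<in> parcs (corona (relabel Base G) H) \<longleftrightarrow> (p, q) \<in> parcs (relabel ?f (corona G H))"
    for p q
  proof -
    have "(p, q) \<in> parcs (relabel ?f (corona G H)) \<longleftrightarrow>
        (\<exists>p' q'. (p', q') \<in> parcs (corona G H) \<and> p = ?f p' \<and> q = ?f q')"
      by (force simp: relabel_def)
    also have "\<dots> \<longleftrightarrow>
        (\<exists>u v. (u, v) \<in> parcs G \<and> p = Inl (Base u) \<and> q = Inl (Base v)) \<or>
        (\<exists>v x y. v \<in> pverts G \<and> (x, y) \<in> parcs H \<and> p = Inr (Base v, x) \<and> q = Inr (Base v, y)) \<or>
        (\<exists>v x. v \<in> pverts G \<and> x \<in> pverts H \<and> p = Inl (Base v) \<and> q = Inr (Base v, x)) \<or>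
        (\<exists>v x. v \<in> pverts G \<and> x \<in> pverts H \<and> p = Inr (Base v, x) \<and> q = Inl (Base v))"
      by (simp add: corona_def conj_disj_distribR ex_disj_distrib) (intro disj_cong; force)
    also have "\<dots> \<longleftrightarrow> (p, q) \<in> parcs (corona (relabel Base G) H)"
      by (simp add: corona_def relabel_def) (intro disj_cong; force)
    finally show ?thesis by simp
  qed
  with verts have "corona (relabel Base G) H = relabel ?f (corona G H)"
    by (intro pair_pre_digraph.equality) auto
  then show ?thesis
    by (simp add: relabel_relabel)
qed

end

theory Submission
  imports Defs
begin

text \<open>A vertex together with an attached odd cycle needs four colours. Conversely, an equitable
  4-colouring of \<open>G\<close> extends to the corona: the cycle on \<open>2k + 1\<close> vertices has a 3-colouring with
  any class sizes that are at most \<open>k\<close> and add up to \<open>2k + 1\<close>. This makes it possible to choose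
  the colourings of the cycles at two vertices of different colours so that every colour occurs
  exactly \<open>k + 1\<close> times on these two vertices and their cycles, and at three vertices of different
  colours so that the four colours occur almost equally often. If \<open>n \<ge> 2\<close>, then the vertices of
  \<open>G\<close> split into such pairs and at most one such triple.\<close>

section \<open>Equitable colourings as colour functions\<close>

text \<open>A colour function extends to a corona more easily than a family of classes. Sizes differ
  pairwise by at most 1 exactly when all lie in \<open>{t, Suc t}\<close>; the least class size
  serves as \<open>t\<close>.\<close>

lemma equitably_colorable_iff:
  assumes "pair_graph G"
  shows "equitably_colorable r G \<longleftrightarrow>
    (\<exists>c t. (\<forall>v\<in>pverts G. c v < r) \<and> (\<forall>(u, v)\<in>parcs G. c u \<noteq> c v) \<and>
       (\<forall>i<r. card {v \<in> pverts G. c v = i} \<in> {t, Suc t}))"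
    (is "?L \<longleftrightarrow> ?R")
proof
  have arcs: "parcs G \<subseteq> pverts G \<times> pverts G"
    using assms by (simp add: pair_graph_iff)
  assume ?L
  then obtain V where V: "(\<Union>i<r. V i) = pverts G" "disjoint_family_on V {..<r}"
    "\<And>i. i < r \<Longrightarrow> independent_set G (V i)"
    "\<And>i j. i < r \<Longrightarrow> j < r \<Longrightarrow> \<bar>int (card (V i)) - int (card (V j))\<bar> \<le> 1"
    unfolding equitably_colorable_def by blast
  have "\<forall>v\<in>pverts G. \<exists>i<r. v \<in> V i"
    using V(1) by blast
  then obtain c where c: "\<And>v. v \<in> pverts G \<Longrightarrow> c v < r \<and> v \<in> V (c v)"
    by metis
  have cV: "c v = i" if "i < r" "v \<in> V i" for i v
  proof (rule ccontr)
    assume "c v \<noteq> i"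
    moreover have "v \<in> pverts G"
      using that V(1) by blast
    ultimately show False
      using c[of v] that V(2) unfolding disjoint_family_on_def by blast
  qed
  have cls: "{v \<in> pverts G. c v = i} = V i" if "i < r" for i
    using that V(1) c cV by blast
  have "c u \<noteq> c v" if "(u, v) \<in> parcs G" for u v
    using that arcs c[of u] c[of v] V(3)[of "c u"] unfolding independent_set_def by auto
  moreover have "\<exists>t. \<forall>i<r. card (V i) \<in> {t, Suc t}"
  \<comment> \<open>Without colours the minimum below would range over the empty set, but then any
    \<open>t\<close> works.\<close>
  proof (cases "r = 0")
    case False
    define t where "t = Min ((\<lambda>i. card (V i)) ` {..<r})"
    have "t \<in> (\<lambda>i. card (V i)) ` {..<r}"
      unfolding t_def using False by (intro Min_in) auto
    then obtain j where j: "j < r" "t = card (V j)" by auto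
    have "t \<le> card (V i)" if "i < r" for i
      unfolding t_def using that by (intro Min_le) auto
    then have "card (V i) \<in> {t, Suc t}" if "i < r" for i
      using that V(4)[OF that j(1)] j(2) by fastforce
    then show ?thesis by blast
  qed auto
  ultimately show ?R
    using c cls by (intro exI[of _ c]) auto
next
  assume ?R
  then obtain c t where c: "\<And>v. v \<in> pverts G \<Longrightarrow> c v < r" "\<And>u v. (u, v) \<in> parcs G \<Longrightarrow> c u \<noteq> c v"
    "\<And>i. i < r \<Longrightarrow> card {v \<in> pverts G. c v = i} \<in> {t, Suc t}"
    by blast
  show ?L
    unfolding equitably_colorable_def
  proof (intro exI[of _ "\<lambda>i. {v \<in> pverts G. c v = i}"] conjI allI impI)
    fix i j assume "i < r" "j < r"
    then show "\<bar>int (card {v \<in> pverts G. c v = i}) - int (card {v \<in> pverts G. c v = j})\<bar> \<le> 1"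
      using c(3)[of i] c(3)[of j] by auto
  next
    fix i assume "i < r"
    show "independent_set G {v \<in> pverts G. c v = i}"
      using c(2) unfolding independent_set_def by blast
  qed (use c(1) in \<open>auto simp: disjoint_family_on_def\<close>)
qed

lemma equitably_colorableE:
  assumes "equitably_colorable r G" "pair_graph G"
  obtains c t where "\<forall>v\<in>pverts G. c v < r" "\<forall>(u, v)\<in>parcs G. c u \<noteq> c v"
    "\<forall>i<r. card {v \<in> pverts G. c v = i} \<in> {t, Suc t}"
  using assms(1) unfolding equitably_colorable_iff[OF assms(2)] by (elim exE conjE)

lemma equitably_colorable_relabel:
  assumes "pair_graph G" "inj f"
  shows "equitably_colorable r (relabel f G) \<longleftrightarrow> equitably_colorable r G"
proof
  assume "equitably_colorable r G"
  from this assms(1) obtain c t where c: "\<forall>v\<in>pverts G. c v < r" "\<forall>(u, v)\<in>parcs G. c u \<noteq> c v"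
    "\<forall>i<r. card {v \<in> pverts G. c v = i} \<in> {t, Suc t}"
    by (rule equitably_colorableE)
  have "{v \<in> pverts (relabel f G). (c \<circ> inv f) v = i} = f ` {v \<in> pverts G. c v = i}" for i
    using assms(2) by (auto simp: relabel_def)
  then have "card {v \<in> pverts (relabel f G). (c \<circ> inv f) v = i} = card {v \<in> pverts G. c v = i}" for i
    using inj_on_subset[OF assms(2)] by (simp add: card_image)
  then show "equitably_colorable r (relabel f G)"
    unfolding equitably_colorable_iff[OF pair_graph_relabel[OF assms]]
    using c assms(2) by (intro exI[of _ "c \<circ> inv f"] exI[of _ t]) (force simp: relabel_def)
next
  assume "equitably_colorable r (relabel f G)"
  from this pair_graph_relabel[OF assms] obtain c t
    where c': "\<forall>v\<in>pverts (relabel f G). c v < r" "\<forall>(u, v)\<in>parcs (relabel f G). c u \<noteq> c v"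
      "\<forall>i<r. card {v \<in> pverts (relabel f G). c v = i} \<in> {t, Suc t}"
    by (rule equitably_colorableE)
  have c: "\<And>v. v \<in> pverts G \<Longrightarrow> c (f v) < r"
    "\<And>u v. (u, v) \<in> parcs G \<Longrightarrow> c (f u) \<noteq> c (f v)"
    "\<And>i. i < r \<Longrightarrow> card {v \<in> f ` pverts G. c v = i} \<in> {t, Suc t}"
    using c' unfolding relabel_def by force+
  have "{v \<in> f ` pverts G. c v = i} = f ` {v \<in> pverts G. c (f v) = i}" for i
    by auto
  then have "card {v \<in> f ` pverts G. c v = i} = card {v \<in> pverts G. (c \<circ> f) v = i}" for i
    using inj_on_subset[OF assms(2)] by (simp add: card_image)
  then show "equitably_colorable r G"
    unfolding equitably_colorable_iff[OF assms(1)]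
    using c by (intro exI[of _ "c \<circ> f"] exI[of _ t]) auto
qed

section \<open>Colourings of odd cycles\<close>

text \<open>Listing the vertices of the odd cycle in steps of two, as \<open>0, 2, \<dots>, 2k, 1, 3, \<dots>, 2k - 1\<close>,
  puts neighbours at distance at least \<open>k\<close>. Hence every interval of at most \<open>k\<close> positions is
  independent, and consecutive intervals can serve as colour classes of prescribed sizes.\<close>

lemma odd_cycle_coloring_with_class_sizes:
  fixes a :: "nat \<Rightarrow> nat"
  assumes "\<And>i. i < r \<Longrightarrow> a i \<le> k" "(\<Sum>i<r. a i) = 2 * k + 1"
  shows "\<exists>h. (\<forall>x<2 * k + 1. h x < r) \<and> (\<forall>(x, y)\<in>parcs (cycle_graph (2 * k + 1)). h x \<noteq> h y) \<and>
    (\<forall>i<r. card {x. x < 2 * k + 1 \<and> h x = i} = a i)"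
proof -
  define pos where "pos x = (if even x then x div 2 else k + 1 + x div 2)" for x :: nat
  \<comment> \<open>\<open>A i\<close> is the first position of the \<open>i\<close>-th interval,
    and \<open>h x\<close> is the index of the interval that contains \<open>pos x\<close>.\<close>
  define A where "A i = (\<Sum>j<i. a j)" for i
  define h where "h x = (LEAST i. pos x < A (Suc i))" for x
  have A_Suc: "A (Suc i) = A i + a i" for i
    by (simp add: A_def)
  have A_mono: "i \<le> j \<Longrightarrow> A i \<le> A j" for i j
    unfolding A_def by (intro sum_mono2) auto
  have A_r: "A r = 2 * k + 1" and A_0: "A 0 = 0"
    using assms(2) by (simp_all add: A_def)
  have r: "r > 0"
    using assms(2) by (cases r) auto
  have pos_less: "pos x < 2 * k + 1" if "x < 2 * k + 1" for x
    using that by (auto simp: pos_def elim!: evenE oddE)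
  have pos_inj: "inj_on pos {..<2 * k + 1}"
    by (rule inj_onI) (auto simp: pos_def elim!: evenE oddE split: if_splits)
  have pos_image: "pos ` {..<2 * k + 1} = {..<2 * k + 1}"
    using pos_less by (intro endo_inj_surj pos_inj) auto
  have h_between: "A (h x) \<le> pos x" "pos x < A (Suc (h x))" "h x < r" if "x < 2 * k + 1" for x
  proof -
    have ex: "pos x < A (Suc (r - 1))"
      using pos_less[OF that] r A_r by simp
    show "pos x < A (Suc (h x))"
      unfolding h_def by (rule LeastI[of _ "r - 1"], rule ex)
    have "h x \<le> r - 1"
      unfolding h_def by (rule Least_le, rule ex)
    then show "h x < r" using r by linarith
    show "A (h x) \<le> pos x"
    proof (cases "h x")
      case (Suc i)
      then have "i < h x" by simp
      then have "\<not> pos x < A (Suc i)"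
        unfolding h_def by (rule not_less_Least)
      then show ?thesis using Suc by simp
    qed (simp add: A_0)
  qed
  have h_eq: "h x = i" if "x < 2 * k + 1" "A i \<le> pos x" "pos x < A (Suc i)" for x i
  proof (rule ccontr)
    assume "h x \<noteq> i"
    then consider "Suc (h x) \<le> i" | "Suc i \<le> h x" by linarith
    then show False
      using A_mono[of "Suc (h x)" i] A_mono[of "Suc i" "h x"] h_between[OF that(1)] that(2,3)
      by cases linarith+
  qed
  have "card {x. x < 2 * k + 1 \<and> h x = i} = a i" if "i < r" for i
  proof -
    have sub: "A (Suc i) \<le> 2 * k + 1"
      using A_mono[of "Suc i" r] that A_r by simp
    have "pos ` {x. x < 2 * k + 1 \<and> h x = i} = {A i..<A (Suc i)}"
    proof (intro equalityI subsetI)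
      fix p assume p: "p \<in> {A i..<A (Suc i)}"
      then have "p \<in> pos ` {..<2 * k + 1}"
        using sub unfolding pos_image by simp
      then show "p \<in> pos ` {x. x < 2 * k + 1 \<and> h x = i}"
        using p h_eq by auto
    qed (use h_between in auto)
    moreover have "inj_on pos {x. x < 2 * k + 1 \<and> h x = i}"
      by (rule inj_on_subset[OF pos_inj]) auto
    ultimately have "card {x. x < 2 * k + 1 \<and> h x = i} = card {A i..<A (Suc i)}"
      using card_image by metis
    then show ?thesis by (simp add: A_Suc)
  qed
  moreover have "h x \<noteq> h y" if xy: "(x, y) \<in> parcs (cycle_graph (2 * k + 1))" for x y
  proof
    assume eq: "h x = h y"
    have less: "x < 2 * k + 1" "y < 2 * k + 1"
      using xy by (auto simp: cycle_graph_def)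
    have far: "pos u + k \<le> pos v \<or> pos v + k \<le> pos u"
      if "u < 2 * k + 1" "v = Suc u mod (2 * k + 1)" for u v
    proof (cases "u = 2 * k")
      case True
      then show ?thesis using that by (simp add: pos_def)
    next
      case False
      then have "v = Suc u" using that by simp
      then show ?thesis by (auto simp: pos_def elim!: evenE oddE)
    qed
    have "pos x + k \<le> pos y \<or> pos y + k \<le> pos x"
      using xy far[of x y] far[of y x] by (auto simp: cycle_graph_def)
    moreover have "a (h x) \<le> k"
      using assms(1) h_between(3)[OF less(1)] by blast
    ultimately show False
      using h_between(1,2)[OF less(1)] h_between(1,2)[OF less(2)] eq by (simp add: A_Suc)
  qed
  ultimately show ?thesis
    using h_between(3) by (intro exI[of _ h]) auto
qed

section \<open>Class sizes for two or three attached cycles\<close>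

text \<open>Naming the two remaining colours turns sums and quantifiers over \<open>{..<4}\<close>
  into explicit four-term expressions.\<close>

lemma four_colors_insert2:
  assumes "i < 4" "j < (4::nat)" "i \<noteq> j"
  obtains p q where "{..<4} = {i, j, p, q}" "distinct [i, j, p, q]"
proof -
  have "card ({..<4} - {i, j}) = 2"
    using assms by (simp add: card_Diff_subset)
  then obtain p q where pq: "{..<4} - {i, j} = {p, q}" "p \<noteq> q"
    by (meson card_2_iff)
  then have "p \<notin> {i, j}" "q \<notin> {i, j}" by blast+
  then have "distinct [i, j, p, q]"
    using pq(2) assms(3) by auto
  moreover have "{..<4} = {i, j} \<union> {p, q}"
    unfolding pq(1)[symmetric] using assms by auto
  then have "{..<4} = {i, j, p, q}"
    by (simp only: insert_is_Un[symmetric] Un_insert_left Un_empty_left)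
  ultimately show thesis
    by (intro that[of p q])
qed

text \<open>\<open>admissible k i a\<close>: the numbers \<open>a x\<close> are possible class sizes for a colouring of the cycle
  on \<open>2k + 1\<close> vertices attached to a vertex of colour \<open>i\<close>.\<close>

definition admissible :: "nat \<Rightarrow> nat \<Rightarrow> (nat \<Rightarrow> nat) \<Rightarrow> bool" where
  "admissible k i a \<longleftrightarrow> a i = 0 \<and> (\<forall>x<4. a x \<le> k) \<and> (\<Sum>x<4. a x) = 2 * k + 1"

text \<open>Each cycle uses the colour of the other vertex \<open>k\<close> times, which together
  with that vertex makes \<open>k + 1\<close>. The remaining two colours occur \<open>k\<close>
  times and once on one cycle, and the other way round on the other.\<close>

lemma pair_weights:
  assumes "i < 4" "j < 4" "i \<noteq> j" "k \<ge> 1"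
  shows "\<exists>a b. admissible k i a \<and> admissible k j b \<and>
    (\<forall>x<4. of_bool (i = x) + a x + (of_bool (j = x) + b x) = k + 1)"
proof -
  obtain p q where pq: "{..<4} = {i, j, p, q}" "distinct [i, j, p, q]"
    using four_colors_insert2[OF assms(1-3)] .
  have lt: "x < 4 \<longleftrightarrow> x = i \<or> x = j \<or> x = p \<or> x = q" for x
    using pq(1) by (metis lessThan_iff insert_iff empty_iff)
  define a where "a = (\<lambda>x. 0)(j := k, p := k, q := 1)"
  define b where "b = (\<lambda>x. 0)(i := k, p := 1, q := k)"
  have "admissible k i a" "admissible k j b"
    unfolding admissible_def pq(1) lt a_def b_def using pq(2) assms(4) by auto
  moreover have "\<forall>x<4. of_bool (i = x) + a x + (of_bool (j = x) + b x) = k + 1"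
    unfolding lt a_def b_def using pq(2) by auto
  ultimately show ?thesis by blast
qed

text \<open>Three vertices and their cycles have \<open>6k + 6\<close> vertices, so each colour
  should occur about \<open>k + 1\<close> plus half of \<open>k + 1\<close> times. Splitting
  \<open>k + 1\<close> into halves \<open>lo\<close> and \<open>hi\<close> gives colours
  \<open>i\<close> and \<open>p\<close> the total \<open>k + 1 + lo\<close>, and \<open>j\<close>
  and \<open>q\<close> the total \<open>k + 1 + hi\<close>.\<close>

lemma triple_weights:
  assumes "i < 4" "j < 4" "p < 4" "distinct [i, j, p]" "k \<ge> 1"
  shows "\<exists>a b d t. admissible k i a \<and> admissible k j b \<and> admissible k p d \<and>
    (\<forall>x<4. of_bool (i = x) + a x + (of_bool (j = x) + b x) + (of_bool (p = x) + d x) \<in> {t, Suc t})"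
proof -
  obtain p' q' where pq': "{..<4} = {i, j, p', q'}" "distinct [i, j, p', q']"
    using four_colors_insert2[of i j] assms by auto
  have "p \<in> {i, j, p', q'}"
    using assms(3) unfolding pq'(1)[symmetric] by simp
  then obtain q where pq: "{..<4} = {i, j, p, q}" "distinct [i, j, p, q]"
    using pq' assms(4) by (auto simp: insert_commute)
  have lt: "x < 4 \<longleftrightarrow> x = i \<or> x = j \<or> x = p \<or> x = q" for x
    using pq(1) by (metis lessThan_iff insert_iff empty_iff)
  define lo where "lo = (k + 1) div 2"
  define hi where "hi = k + 1 - lo"
  have lohi: "lo + hi = k + 1" "hi = lo \<or> hi = Suc lo" "lo \<le> k" "hi \<le> k"
    unfolding lo_def hi_def using assms(5) by presburger+
  define a where "a = (\<lambda>x. 0)(j := k, p := lo, q := hi)"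
  define b where "b = (\<lambda>x. 0)(i := lo, p := k, q := hi)"
  define d where "d = (\<lambda>x. 0)(i := k, j := hi, q := lo)"
  have "admissible k i a" "admissible k j b" "admissible k p d"
    unfolding admissible_def pq(1) lt a_def b_def d_def using pq(2) lohi by auto
  moreover have "\<forall>x<4. of_bool (i = x) + a x + (of_bool (j = x) + b x) + (of_bool (p = x) + d x)
      \<in> {k + 1 + lo, Suc (k + 1 + lo)}"
    unfolding lt a_def b_def d_def using pq(2) lohi by auto
  ultimately show ?thesis by blast
qed

section \<open>Distribution of weights over all vertices\<close>

text \<open>Removal takes one element from each of two largest classes. If two classes have size
  \<open>Suc t\<close>, the bound \<open>t\<close> stays; otherwise at most one is that large and
  the bound drops to \<open>t - 1\<close>.\<close>

lemma equitable_remove_pair: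
  fixes N :: "nat \<Rightarrow> nat"
  assumes "\<And>x. x < 4 \<Longrightarrow> N x \<in> {t, Suc t}" "(\<Sum>x<4. N x) \<ge> 2"
  shows "\<exists>i j s. i < 4 \<and> j < 4 \<and> i \<noteq> j \<and> N i > 0 \<and> N j > 0 \<and>
    (\<forall>x<4. N x - of_bool (x = i) - of_bool (x = j) \<in> {s, Suc s})"
proof (cases "\<exists>i j. i < 4 \<and> j < 4 \<and> i \<noteq> j \<and> N i = Suc t \<and> N j = Suc t")
  case True
  then obtain i j where "i < 4" "j < 4" "i \<noteq> j" "N i = Suc t" "N j = Suc t" by blast
  then show ?thesis
    using assms(1) by (intro exI[of _ i] exI[of _ j] exI[of _ t]) auto
next
  case False
  \<comment> \<open>If no class has size \<open>Suc t\<close>, all have size \<open>t\<close>, and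
    the default \<open>0\<close> is as good as any colour.\<close>
  define i where "i = (if \<exists>i<4. N i = Suc t then SOME i. i < 4 \<and> N i = Suc t else 0)"
  have i: "i < 4 \<and> (N i = Suc t \<or> (\<forall>x<4. N x \<noteq> Suc t))"
    unfolding i_def using someI_ex[of "\<lambda>i. i < 4 \<and> N i = Suc t"] by auto
  then have others: "N x = t" if "x < 4" "x \<noteq> i" for x
    using that False assms(1)[of x] by auto
  \<comment> \<open>For \<open>t = 0\<close> only class \<open>i\<close> could be nonempty, with at
    most one element, against the total of at least 2.\<close>
  have "t > 0"
  proof (rule ccontr)
    assume "\<not> t > 0"
    then have "(\<Sum>x<4. N x) = (\<Sum>x\<in>{i}. N x)"
      using others i by (intro sum.mono_neutral_right) auto
    also have "\<dots> \<le> 1"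
      using assms(1)[of i] i \<open>\<not> t > 0\<close> by auto
    finally show False using assms(2) by simp
  qed
  define j :: nat where "j = (if i = 0 then 1 else 0)"
  have j: "j < 4" "i \<noteq> j" by (auto simp: j_def)
  show ?thesis
    using i j others assms(1)[of i] \<open>t > 0\<close>
    by (intro exI[of _ i] exI[of _ j] exI[of _ "t - 1"]) auto
qed

text \<open>Two vertices of different colours can be given weights that contribute exactly \<open>k + 1\<close> to
  every colour, so such pairs are split off greedily; an odd number of vertices ends with
  three vertices of different colours.\<close>

lemma equitable_weights:
  fixes c :: "'a \<Rightarrow> nat"
  assumes "finite S" "\<And>v. v \<in> S \<Longrightarrow> c v < 4" "card S \<noteq> 1" "k \<ge> 1"
    and "\<And>i. i < 4 \<Longrightarrow> card {v \<in> S. c v = i} \<in> {t, Suc t}"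
  shows "\<exists>f s. (\<forall>v\<in>S. admissible k (c v) (f v)) \<and>
    (\<forall>i<4. (\<Sum>v\<in>S. of_bool (c v = i) + f v i) \<in> {s, Suc s})"
  using assms
proof (induction "card S" arbitrary: S t rule: less_induct)
  case less
  note fin = less.prems(1) and c = less.prems(2)
  define N where "N i = card {v \<in> S. c v = i}" for i
  have N: "N i \<in> {t, Suc t}" if "i < 4" for i
    using less.prems(5) that unfolding N_def by blast
  have "card S = card (\<Union>i<4. {v \<in> S. c v = i})"
    using c by (intro arg_cong[of _ _ card]) auto
  also have "\<dots> = (\<Sum>i<4. N i)"
    unfolding N_def using fin by (intro card_UN_disjoint) auto
  finally have card_S: "card S = (\<Sum>i<4. N i)" .
  \<comment> \<open>Size 3 is a base case because removing a pair would leave a single vertex, a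
    size to which the induction hypothesis does not apply.\<close>
  consider "card S = 0" | "card S = 3" | "card S \<ge> 2" "card S \<noteq> 3"
    using less.prems(3) by linarith
  then show ?case
  proof cases
    case 1
    then show ?thesis using fin by auto
  next
    case 2
    have "(\<Sum>i<(4::nat). t) \<le> (\<Sum>i<4. N i)"
      using N by (intro sum_mono) fastforce
    \<comment> \<open>Four classes of size at least \<open>t\<close> have only three elements in
      total. Hence no colour repeats on \<open>S\<close>.\<close>
    then have "t = 0"
      using 2 card_S by simp
    obtain u v w where S: "S = {u, v, w}" "distinct [u, v, w]"
      using 2 by (auto simp: card_3_iff)
    have inj: "c x \<noteq> c y" if "x \<in> S" "y \<in> S" "x \<noteq> y" for x y
    proof
      assume "c x = c y"
      then have "card {x, y} \<le> N (c x)"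
        unfolding N_def using that fin by (intro card_mono) auto
      then show False
        using N[of "c x"] c that \<open>t = 0\<close> by auto
    qed
    have "distinct [c u, c v, c w]"
      using inj S by auto
    then obtain a b d s where abd: "admissible k (c u) a" "admissible k (c v) b" "admissible k (c w) d"
      "\<forall>x<4. of_bool (c u = x) + a x + (of_bool (c v = x) + b x) + (of_bool (c w = x) + d x) \<in> {s, Suc s}"
      using triple_weights[of "c u" "c v" "c w" k] c less.prems(4) S by auto
    define f where "f = (\<lambda>_. a)(v := b, w := d)"
    have "\<forall>x\<in>S. admissible k (c x) (f x)"
      using abd S by (auto simp: f_def)
    moreover have "(\<Sum>x\<in>S. of_bool (c x = i) + f x i) =
        of_bool (c u = i) + a i + (of_bool (c v = i) + b i) + (of_bool (c w = i) + d i)" for i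
      using S by (auto simp: f_def)
    ultimately show ?thesis
      using abd(4) by (intro exI[of _ f] exI[of _ s]) presburger
  next
    case 3
    then obtain i j s where ij: "i < 4" "j < 4" "i \<noteq> j" "N i > 0" "N j > 0"
      "\<forall>x<4. N x - of_bool (x = i) - of_bool (x = j) \<in> {s, Suc s}"
      using equitable_remove_pair[of N t] N card_S by metis
    obtain u v where uv: "u \<in> S" "c u = i" "v \<in> S" "c v = j"
      using ij(4,5) unfolding N_def by (auto simp: card_gt_0_iff)
    then have "u \<noteq> v" using ij(3) by auto
    define R where "R = S - {u, v}"
    have S: "S = insert u (insert v R)" "u \<notin> insert v R" "v \<notin> R" "finite R"
      using uv \<open>u \<noteq> v\<close> fin by (auto simp: R_def)
    then have card_R: "card S = card R + 2" by simp
    have "card {x \<in> R. c x = y} \<in> {s, Suc s}" if "y < 4" for y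
    proof -
      have "{x \<in> R. c x = y} = {x \<in> S. c x = y} - {x \<in> {u, v}. c x = y}"
        unfolding R_def by auto
      then have "card {x \<in> R. c x = y} = N y - card {x \<in> {u, v}. c x = y}"
        unfolding N_def using uv by (simp only:) (rule card_Diff_subset; auto)
      also have "card {x \<in> {u, v}. c x = y} = (of_bool (y = i) + of_bool (y = j) :: nat)"
      proof -
        have "{x \<in> {u, v}. c x = y} = (if y = i then {u} else if y = j then {v} else {})"
          using uv ij(3) by auto
        then show ?thesis using ij(3) by simp
      qed
      finally show ?thesis
        using ij(6) that by (simp add: diff_diff_left)
    qed
    moreover have "card R < card S" "card R \<noteq> 1"
      using 3 card_R by auto
    ultimately obtain f s where f: "\<forall>v\<in>R. admissible k (c v) (f v)"
      "\<forall>i<4. (\<Sum>v\<in>R. of_bool (c v = i) + f v i) \<in> {s, Suc s}"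
      using less.hyps[of R s] S c less.prems(4) by auto
    obtain a b where ab: "admissible k i a" "admissible k j b"
      "\<forall>x<4. of_bool (i = x) + a x + (of_bool (j = x) + b x) = k + 1"
      using pair_weights[OF ij(1-3) less.prems(4)] by blast
    define g where "g = f(u := a, v := b)"
    have "\<forall>x\<in>S. admissible k (c x) (g x)"
      using f(1) ab uv S by (auto simp: g_def)
    \<comment> \<open>The pair adds exactly \<open>k + 1\<close> to every colour, so the bound for
      \<open>R\<close> is merely shifted.\<close>
    moreover have "(\<Sum>x\<in>S. of_bool (c x = y) + g x y) \<in> {k + 1 + s, Suc (k + 1 + s)}"
      if "y < 4" for y
    proof -
      have "(\<Sum>x\<in>R. of_bool (c x = y) + g x y) = (\<Sum>x\<in>R. of_bool (c x = y) + f x y)"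
        using S by (intro sum.cong) (auto simp: g_def)
      then have "(\<Sum>x\<in>S. of_bool (c x = y) + g x y) =
          of_bool (i = y) + a y + (of_bool (j = y) + b y) + (\<Sum>x\<in>R. of_bool (c x = y) + f x y)"
        using S uv \<open>u \<noteq> v\<close> by (simp add: g_def)
      then show ?thesis
        using ab(3) f(2) that by auto
    qed
    ultimately show ?thesis by blast
  qed
qed

section \<open>Extension of a colouring to the corona\<close>

text \<open>The colouring of \<open>G\<close> is kept, and each cycle is coloured with the class
  sizes supplied by \<open>equitable_weights\<close>. Admissibility gives the colour of the attached
  vertex size 0 on its cycle, so the joining edges are proper too.\<close>

lemma equitably_4_colorable_corona_odd_cycle:
  fixes G :: "'a pair_pre_digraph"
  assumes "pair_graph G" "card (pverts G) \<ge> 2" "equitably_colorable 4 G" "k \<ge> 1"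
  shows "equitably_colorable 4 (corona G (cycle_graph (2 * k + 1)))"
proof -
  let ?C = "cycle_graph (2 * k + 1)"
  have fin: "finite (pverts G)"
    using assms(1) by (simp add: pair_graph_iff)
  from assms(3,1) obtain c :: "'a \<Rightarrow> nat" and t
    where c': "\<forall>v\<in>pverts G. c v < 4" "\<forall>(u, v)\<in>parcs G. c u \<noteq> c v"
      "\<forall>i<4. card {v \<in> pverts G. c v = i} \<in> {t, Suc t}"
    by (rule equitably_colorableE)
  then have c: "\<And>v. v \<in> pverts G \<Longrightarrow> c v < 4" "\<And>u v. (u, v) \<in> parcs G \<Longrightarrow> c u \<noteq> c v"
    "\<And>i. i < 4 \<Longrightarrow> card {v \<in> pverts G. c v = i} \<in> {t, Suc t}"
    by blast+
  obtain f s where "\<forall>v\<in>pverts G. admissible k (c v) (f v)"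
    "\<forall>i<4. (\<Sum>v\<in>pverts G. of_bool (c v = i) + f v i) \<in> {s, Suc s}"
    using equitable_weights[OF fin c(1) _ assms(4) c(3)] assms(2) by auto
  then have f: "\<And>v. v \<in> pverts G \<Longrightarrow> admissible k (c v) (f v)"
    "\<And>i. i < 4 \<Longrightarrow> (\<Sum>v\<in>pverts G. of_bool (c v = i) + f v i) \<in> {s, Suc s}"
    by blast+
  have "\<forall>v\<in>pverts G. \<exists>h. (\<forall>x<2 * k + 1. h x < 4) \<and> (\<forall>(x, y)\<in>parcs ?C. h x \<noteq> h y) \<and>
      (\<forall>i<4. card {x. x < 2 * k + 1 \<and> h x = i} = f v i)"
    using f(1) unfolding admissible_def by (intro ballI odd_cycle_coloring_with_class_sizes) auto
  then obtain h where "\<forall>v\<in>pverts G. (\<forall>x<2 * k + 1. h v x < 4) \<and>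
      (\<forall>(x, y)\<in>parcs ?C. h v x \<noteq> h v y) \<and> (\<forall>i<4. card {x. x < 2 * k + 1 \<and> h v x = i} = f v i)"
    by (rule bchoice[THEN exE])
  then have h: "\<And>v x. v \<in> pverts G \<Longrightarrow> x < 2 * k + 1 \<Longrightarrow> h v x < 4"
    "\<And>v x y. v \<in> pverts G \<Longrightarrow> (x, y) \<in> parcs ?C \<Longrightarrow> h v x \<noteq> h v y"
    "\<And>v i. v \<in> pverts G \<Longrightarrow> i < 4 \<Longrightarrow> card {x. x < 2 * k + 1 \<and> h v x = i} = f v i"
    by blast+
  have apex: "h v x \<noteq> c v" if "v \<in> pverts G" "x < 2 * k + 1" for v x
  proof -
    have "card {x. x < 2 * k + 1 \<and> h v x = c v} = 0"
      using h(3) f(1) c(1) that unfolding admissible_def by simp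
    then show ?thesis
      using that by auto
  qed
  define c' where "c' = case_sum c (\<lambda>(v, x). h v x)"
  have verts: "pverts ?C = {..<2 * k + 1}"
    by (simp add: cycle_graph_def)
  have count: "card {w \<in> pverts (corona G ?C). c' w = i} = (\<Sum>v\<in>pverts G. of_bool (c v = i) + f v i)"
    if "i < 4" for i
  proof -
    let ?X = "{v \<in> pverts G. c v = i}" and ?Y = "SIGMA v:pverts G. {x. x < 2 * k + 1 \<and> h v x = i}"
    have "{w \<in> pverts (corona G ?C). c' w = i} = Inl ` ?X \<union> Inr ` ?Y"
      unfolding c'_def corona_def verts by auto
    moreover have "card (Inl ` ?X \<union> Inr ` ?Y :: ('a + 'a \<times> nat) set) = card ?X + card ?Y"
      using fin by (subst card_Un_disjoint) (auto simp: card_image)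
    moreover have "card ?Y = (\<Sum>v\<in>pverts G. f v i)"
      using fin h(3) that by (simp add: card_SigmaI)
    moreover have "card ?X = (\<Sum>v\<in>pverts G. of_bool (c v = i))"
      using fin by (simp add: sum_of_bool_eq Int_def)
    ultimately show ?thesis
      by (simp add: sum.distrib)
  qed
  have "pair_graph (corona G ?C)"
    using assms(1,4) by (intro pair_graph_corona pair_graph_cycle_graph) auto
  have "\<forall>w\<in>pverts (corona G ?C). c' w < 4"
    using c(1) h(1) unfolding corona_def verts by (auto simp: c'_def)
  moreover have "\<forall>(w, w')\<in>parcs (corona G ?C). c' w \<noteq> c' w'"
    using c(2) h(2) apex apex[symmetric] unfolding corona_def verts by (auto simp: c'_def)
  moreover have "\<forall>i<4. card {w \<in> pverts (corona G ?C). c' w = i} \<in> {s, Suc s}"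
    using count f(2) by simp
  ultimately show ?thesis
    unfolding equitably_colorable_iff[OF \<open>pair_graph (corona G ?C)\<close>] by blast
qed

section \<open>The lower bound\<close>

text \<open>A cycle must avoid the colour of its vertex, so at most two colours are left for it.
  They alternate along \<open>0, ..., 2k\<close>, and the closing edge joins two vertices of equal
  colour.\<close>

lemma not_colorable_corona_odd_cycle:
  assumes "pair_graph G" "pverts G \<noteq> {}" "k \<ge> 1" "r < 4"
  shows "\<not> equitably_colorable r (corona G (cycle_graph (2 * k + 1)))"
proof
  let ?C = "cycle_graph (2 * k + 1)"
  assume "equitably_colorable r (corona G ?C)"
  moreover have "pair_graph (corona G ?C)"
    using assms(1,3) by (intro pair_graph_corona pair_graph_cycle_graph) auto
  ultimately obtain c t where "\<forall>w\<in>pverts (corona G ?C). c w < r"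
    "\<forall>(w, w')\<in>parcs (corona G ?C). c w \<noteq> c w'"
    "\<forall>i<r. card {w \<in> pverts (corona G ?C). c w = i} \<in> {t, Suc t}"
    by (rule equitably_colorableE)
  then have c: "\<And>w. w \<in> pverts (corona G ?C) \<Longrightarrow> c w < r"
    "\<And>w w'. (w, w') \<in> parcs (corona G ?C) \<Longrightarrow> c w \<noteq> c w'"
    by blast+
  obtain v where v: "v \<in> pverts G"
    using assms(2) by blast
  define d where "d x = c (Inr (v, x))" for x
  have d: "d x < r" "d x \<noteq> c (Inl v)" if "x < 2 * k + 1" for x
    using that v c(1)[of "Inr (v, x)"] c(2)[of "Inr (v, x)" "Inl v"]
    by (auto simp: d_def corona_def cycle_graph_def)
  have adj: "d x \<noteq> d y" if "(x, y) \<in> parcs ?C" for x y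
    unfolding d_def using that v by (intro c(2)) (auto simp: corona_def)
  have "c (Inl v) < r"
    using v by (intro c(1)) (simp add: corona_def)
  have "x < 2 * k + 1 \<Longrightarrow> d x = d 0 \<longleftrightarrow> even x" for x
  proof (induction x)
    case (Suc x)
    then have "(x, Suc x) \<in> parcs ?C"
      by (simp add: cycle_graph_def)
    then have "d x \<noteq> d (Suc x)" by (rule adj)
    moreover have "d 0 \<noteq> d 1"
      using assms(3) by (intro adj) (simp add: cycle_graph_def)
    \<comment> \<open>\<open>d 0\<close>, \<open>d x\<close> and \<open>d (Suc x)\<close> take at
      most two values, since all are below \<open>r\<close> and differ from
      \<open>c (Inl v)\<close>.\<close>
    ultimately have "d (Suc x) = d 0 \<longleftrightarrow> d x \<noteq> d 0"
      using d[of 0] d[of x] d[of "Suc x"] Suc.prems \<open>c (Inl v) < r\<close> assms(4) by auto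
    then show ?case using Suc by simp
  qed simp
  then have "d (2 * k) = d 0" by simp
  moreover have "d (2 * k) \<noteq> d 0"
    by (intro adj) (simp add: cycle_graph_def)
  ultimately show False by simp
qed

section \<open>Iterated coronas\<close>

text \<open>The vertex count is carried through the induction because every further corona step
  requires at least two vertices.\<close>

lemma equitably_4_colorable_iterated_corona:
  fixes G :: "'a pair_pre_digraph"
  assumes "pair_graph G" "card (pverts G) \<ge> 2" "equitably_colorable 4 G" "k \<ge> 1"
  shows "card (pverts (iterated_corona l G (cycle_graph (2 * k + 1)))) \<ge> 2 \<and>
    equitably_colorable 4 (iterated_corona l G (cycle_graph (2 * k + 1)))"
proof (induction l)
  case 0
  have inj: "inj (Base :: 'a \<Rightarrow> ('a, nat) corona_vertex)" by (simp add: inj_def)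
  have "card (pverts (relabel (Base :: 'a \<Rightarrow> ('a, nat) corona_vertex) G)) = card (pverts G)"
    by (simp add: relabel_def card_image inj_on_def)
  then show ?case
    using assms equitably_colorable_relabel[OF assms(1) inj] by simp
next
  case (Suc l)
  let ?C = "cycle_graph (2 * k + 1)" and ?G = "iterated_corona l G (cycle_graph (2 * k + 1))"
  have C: "pair_graph ?C"
    using assms(4) by (intro pair_graph_cycle_graph) auto
  have G: "pair_graph ?G"
    using assms(1) C by (rule pair_graph_iterated_corona)
  have GC: "pair_graph (corona ?G ?C)"
    using G C by (rule pair_graph_corona)
  have "inj Step" by (simp add: inj_def)
  have "card (pverts ?G) = card ((Inl :: _ \<Rightarrow> _ + ('a, nat) corona_vertex \<times> nat) ` pverts ?G)"
    by (simp add: card_image)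
  also have "\<dots> \<le> card (pverts (corona ?G ?C))"
    using GC by (intro card_mono) (auto simp: pair_graph_iff corona_def)
  also have "\<dots> = card (pverts (relabel Step (corona ?G ?C)))"
    by (simp add: relabel_def card_image inj_on_def)
  finally show ?case
    using equitably_4_colorable_corona_odd_cycle[OF G _ _ assms(4)] Suc
      equitably_colorable_relabel[OF GC \<open>inj Step\<close>] by simp
qed

theorem theorem5:
  fixes G :: "'a pair_pre_digraph" and n k l :: nat
  assumes "pair_graph G"
    and "Digraph_Component.connected (with_proj G)"
    and "card (pverts G) = n" and "n \<ge> 2"
    and "equitably_colorable 4 G"
    and "k \<ge> 1"
    and "l \<ge> 1"
  shows "equitable_chromatic_number (iterated_corona l G (cycle_graph (2 * k + 1))) = 4"
proof -
  let ?C = "cycle_graph (2 * k + 1)"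
  note colorable = equitably_4_colorable_iterated_corona[OF assms(1) _ assms(5,6)]
  \<comment> \<open>Since \<open>l\<close> is positive, the outermost operation is a corona with the
    odd cycle, to which the lower bound applies.\<close>
  obtain l' where l: "l = Suc l'"
    using assms(7) by (cases l) auto
  let ?G = "iterated_corona l' G ?C"
  have C: "pair_graph ?C"
    using assms(6) by (intro pair_graph_cycle_graph) auto
  have G: "pair_graph ?G"
    using assms(1) C by (rule pair_graph_iterated_corona)
  have "inj Step" by (simp add: inj_def)
  have ne: "pverts ?G \<noteq> {}"
    using colorable[of l'] assms(3,4) by auto
  have "\<not> equitably_colorable r (iterated_corona l G ?C)" if "r < 4" for r
    using not_colorable_corona_odd_cycle[OF G ne assms(6) that]
      equitably_colorable_relabel[OF pair_graph_corona[OF G C] \<open>inj Step\<close>] l by simp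
  then show ?thesis
    unfolding equitable_chromatic_number_def
    using colorable[of l] assms(3,4) by (intro Least_equality) (auto simp: not_less[symmetric])
qed

end
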